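(* Let $a$ be a positive integer. Then $a^{n}+1$ is the sum of two squares for every positive integer $n$ if and only if $a$ is a perfect square.
   Context: An integer $N$ is "the sum of two squares" if $N = s^2+t^2$ for some integers $s,t$ (zero is allowed). *)

theory Defs
  imports "HOL-Number_Theory.Number_Theory" "HOL-Computational_Algebra.Nth_Powers"
begin

definition sum_of_two_squares :: "int \<Rightarrow> bool" where
  "sum_of_two_squares N \<longleftrightarrow> (\<exists>s t :: int. N = s\<^sup>2 + t\<^sup>2)"

end

theory Submission
  imports Defs "HOL-Analysis.Summation_Tests"
begin

text \<open>
  If \<open>a = b\<^sup>2\<close>, then \<open>a ^ n + 1 = (b ^ n)\<^sup>2 + 1\<^sup>2\<close>. The content is the converse. A prime \<open>p\<close> that is 3 modulo 4
  divides a positive sum of two squares to an even power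
  (\<open>even_multiplicity_sum_of_two_squares\<close>). So suppose that some prime \<open>p\<close> is 3 modulo 4 and has \<open>a\<close> as a
  quadratic nonresidue, and put \<open>n = (p - 1) div 2\<close>. By Euler's criterion \<open>p\<close> divides \<open>a ^ n + 1\<close>.
  As \<open>n\<close> and \<open>p\<close> are odd, lifting the exponent (\<open>multiplicity_power_prime_plus_one\<close>)
  shows that the power of \<open>p\<close> in \<open>a ^ (n * p) + 1\<close> is exactly one more than that in \<open>a ^ n + 1\<close>, so
  the two numbers cannot both be sums of two squares.

  It remains to find such a prime for every nonsquare \<open>a\<close>
  (\<open>exists_prime_3_mod_4_nonresidue\<close>). After removing factors 4 this is elementary unless \<open>a\<close> is 1
  modulo 4. In that case, by quadratic reciprocity, \<open>p\<close> must take the value -1 under two quadratic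
  characters of modulus \<open>4 * a\<close>: the character modulo 4 and the Jacobi symbol over \<open>a\<close>. The theorem
  \<open>exists_prime_both_minus_one\<close> finds \<open>p\<close> for any two nonprincipal quadratic characters \<open>f\<close>, \<open>g\<close> of a common
  modulus. If there were no such prime, every
  Euler factor of the Dirichlet convolution \<open>G\<close> of \<open>f\<close> and \<open>g\<close> would be nonnegative, and \<open>G\<close> would be at least
  1 at squares coprime to the modulus. Then the sum of \<open>G n / sqrt n\<close> over \<open>n \<le> N\<^sup>2\<close> would
  dominate a multiple of the harmonic series. But \<open>f\<close> and \<open>g\<close> have bounded partial sums, and the
  hyperbola method (\<open>abs_convolution_sum_le\<close>) bounds the same sum independently of \<open>N\<close>.
\<close>

section \<open>Bounded partial sums and the hyperbola method\<close>

text \<open>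
  Summation by parts: the partial sums of \<open>g\<close> are bounded and \<open>w\<close> decreases, so the variation of \<open>w\<close>
  telescopes. Choosing \<open>w n = 1 / sqrt n\<close> gives tails that decay even though
  \<open>1 / sqrt n\<close> itself is not summable.
\<close>

lemma abs_weighted_sum_le:
  fixes g w :: "nat \<Rightarrow> real"
  assumes bound: "\<And>n. \<bar>\<Sum>i<n. g i\<bar> \<le> B"
    and w_nonneg: "\<And>n. A \<le> n \<Longrightarrow> 0 \<le> w n"
    and w_decreasing: "\<And>n. A \<le> n \<Longrightarrow> w (Suc n) \<le> w n"
  shows "\<bar>\<Sum>n\<in>{A..<K}. g n * w n\<bar> \<le> 2 * B * w A"
proof (cases "A \<le> K")
  case True
  define S where "S n = (\<Sum>i<n. g i)" for n
  \<comment> \<open>The boundary terms cost \<open>B * w A\<close> at the start and the telescoping sum costs \<open>B * (w A - w K)\<close>.\<close>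
  have "\<bar>(\<Sum>n\<in>{A..<K}. g n * w n) - S K * w K\<bar> \<le> B * (2 * w A - w K)"
    using True
  proof (induction K rule: dec_induct)
    case base
    have "\<bar>S A * w A\<bar> \<le> B * w A"
      unfolding abs_mult S_def using bound[of A] w_nonneg[of A] by (simp add: mult_right_mono)
    then show ?case by simp
  next
    case (step K)
    have "\<bar>S (Suc K) * (w K - w (Suc K))\<bar> \<le> B * (w K - w (Suc K))"
      unfolding abs_mult S_def using bound[of "Suc K"] w_decreasing[of K] step.hyps
      by (simp add: mult_right_mono)
    moreover have "(\<Sum>n\<in>{A..<Suc K}. g n * w n) - S (Suc K) * w (Suc K)
        = ((\<Sum>n\<in>{A..<K}. g n * w n) - S K * w K) + S (Suc K) * (w K - w (Suc K))"
      using step.hyps by (simp add: S_def algebra_simps)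
    ultimately show ?case using step.IH by (simp add: algebra_simps)
  qed
  moreover have "\<bar>S K * w K\<bar> \<le> B * w K"
    unfolding abs_mult S_def using bound[of K] w_nonneg[of K] True by (simp add: mult_right_mono)
  ultimately show ?thesis by (simp add: algebra_simps)
next
  case False
  have "0 \<le> B" using bound[of 0] by simp
  with False w_nonneg[of A] show ?thesis by simp
qed

corollary abs_sum_over_sqrt_le:
  fixes g :: "nat \<Rightarrow> real"
  assumes "\<And>n. \<bar>\<Sum>i<n. g i\<bar> \<le> B" and "A > 0"
  shows "\<bar>\<Sum>n\<in>{A..<K}. g n / sqrt n\<bar> \<le> 2 * B / sqrt A"
  using abs_weighted_sum_le[of g B A "\<lambda>n. 1 / sqrt n" K] assms
  by (simp add: frac_le)

lemma sum_inverse_sqrt_le: "(\<Sum>n\<in>{1..<Suc N}. 1 / sqrt (real n)) \<le> 2 * sqrt N"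
proof (induction N)
  case (Suc N)
  have "1 / sqrt (real (Suc N)) \<le> 2 * (sqrt (Suc N) - sqrt N)"
  proof -
    have pos: "0 < sqrt (real (Suc N))" by simp
    \<comment> \<open>Expanding this square uses \<open>sqrt (N + 1) ^ 2 - sqrt N ^ 2 = 1\<close>.\<close>
    have "0 \<le> (sqrt (real (Suc N)) - sqrt N)\<^sup>2" by simp
    then have "1 \<le> 2 * (sqrt (Suc N) - sqrt N) * sqrt (Suc N)"
      by (simp add: power2_diff algebra_simps real_sqrt_mult_self flip: power2_eq_square)
    then show ?thesis using pos by (simp add: divide_le_eq del: of_nat_Suc)
  qed
  then have "(\<Sum>n\<in>{1..<Suc N}. 1 / sqrt (real n)) + 1 / sqrt (real (Suc N))
      \<le> 2 * sqrt N + 2 * (sqrt (Suc N) - sqrt N)"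
    by (rule add_mono[OF Suc.IH])
  then show ?case by (simp add: algebra_simps)
qed simp

definition dirichlet_convolution :: "(nat \<Rightarrow> 'a :: comm_semiring_1) \<Rightarrow> (nat \<Rightarrow> 'a) \<Rightarrow> nat \<Rightarrow> 'a" where
  "dirichlet_convolution f g n = (\<Sum>d | d dvd n. f d * g (n div d))"

text \<open>
  The region under the hyperbola \<open>d * e \<le> N\<^sup>2\<close> consists of the square with side \<open>N\<close> and two wings, in each
  of which one coordinate is at most \<open>N\<close> and the other exceeds \<open>N\<close>. On a wing the inner tail is
  \<open>O(1 / sqrt N)\<close>, uniformly in its upper end \<open>K d\<close>, and the outer weights \<open>1 / sqrt d\<close> add up to
  \<open>O(sqrt N)\<close>, so the wing contributes a bounded amount.
\<close>

lemma abs_hyperbola_wing_le: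
  fixes f g :: "nat \<Rightarrow> real"
  assumes f: "\<And>n. \<bar>f n\<bar> \<le> 1" and g: "\<And>n. \<bar>\<Sum>i<n. g i\<bar> \<le> B"
  shows "\<bar>\<Sum>d\<in>{1..<Suc N}. f d / sqrt d * (\<Sum>e\<in>{Suc N..<K d}. g e / sqrt e)\<bar> \<le> 4 * B"
proof -
  have B: "0 \<le> B" using g[of 0] by simp
  have "\<bar>\<Sum>d\<in>{1..<Suc N}. f d / sqrt d * (\<Sum>e\<in>{Suc N..<K d}. g e / sqrt e)\<bar>
      \<le> (\<Sum>d\<in>{1..<Suc N}. 1 / sqrt d * (2 * B / sqrt (Suc N)))"
  proof (intro order.trans[OF sum_abs] sum_mono)
    fix d assume "d \<in> {1..<Suc N}"
    have "\<bar>f d / sqrt d\<bar> \<le> 1 / sqrt d"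
      using f[of d] by (simp add: divide_right_mono)
    moreover have "\<bar>\<Sum>e\<in>{Suc N..<K d}. g e / sqrt e\<bar> \<le> 2 * B / sqrt (Suc N)"
      by (rule abs_sum_over_sqrt_le[OF g]) simp
    ultimately show "\<bar>f d / sqrt d * (\<Sum>e\<in>{Suc N..<K d}. g e / sqrt e)\<bar>
        \<le> 1 / sqrt d * (2 * B / sqrt (Suc N))"
      unfolding abs_mult by (intro mult_mono) simp_all
  qed
  also have "\<dots> = (\<Sum>d\<in>{1..<Suc N}. 1 / sqrt (real d)) * (2 * B / sqrt (Suc N))"
    by (rule sum_distrib_right[symmetric])
  also have "\<dots> \<le> 2 * sqrt N * (2 * B / sqrt (Suc N))"
    by (intro mult_right_mono sum_inverse_sqrt_le) (simp add: B)
  also have "\<dots> = 4 * B * (sqrt N / sqrt (Suc N))" by simp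
  also have "\<dots> \<le> 4 * B * 1"
    using B by (intro mult_left_mono) (simp_all add: divide_le_eq_1)
  finally show ?thesis by simp
qed

text \<open>
  The analytic half of the argument. On the square the double sum is a product of two bounded sums,
  and the two wings are bounded by the previous lemma. The weight \<open>1 / sqrt n\<close> is the critical one: for
  a convolution that is at least 1 on squares the same sum grows like the harmonic series.
\<close>

lemma abs_convolution_sum_le:
  fixes f g :: "nat \<Rightarrow> real"
  assumes f1: "\<And>n. \<bar>f n\<bar> \<le> 1" and g1: "\<And>n. \<bar>g n\<bar> \<le> 1"
    and f: "\<And>n. \<bar>\<Sum>i<n. f i\<bar> \<le> B" and g: "\<And>n. \<bar>\<Sum>i<n. g i\<bar> \<le> B"
  shows "\<bar>\<Sum>n\<in>{1..N\<^sup>2}. dirichlet_convolution f g n / sqrt n\<bar> \<le> 4 * B\<^sup>2 + 8 * B"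
proof -
  define h where "h = (\<lambda>(d::nat, e::nat). f d / sqrt d * (g e / sqrt e))"
  define Box where "Box = {1..<Suc N} \<times> {1..<Suc N}"
  define Up where "Up = Sigma {1..<Suc N} (\<lambda>d. {Suc N..<Suc (N\<^sup>2 div d)})"
  define Right where "Right = prod.swap ` Up"
  have fin: "finite Box" "finite Up" "finite Right"
    by (auto simp: Box_def Up_def Right_def)
  have B: "0 \<le> B" using g[of 0] by simp
  have Right_iff: "(d, e) \<in> Right \<longleftrightarrow> (e, d) \<in> Up" for d e
    unfolding Right_def by force
  have Up_iff: "(d, e) \<in> Up \<longleftrightarrow> 1 \<le> d \<and> d \<le> N \<and> N < e \<and> d * e \<le> N\<^sup>2" for d e
    unfolding Up_def by (auto simp: less_Suc_eq_le less_eq_div_iff_mult_less_eq mult.commute)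
  have large: False if "N < d" "N < e" "d * e \<le> N\<^sup>2" for d e :: nat
  proof -
    have "N * N < d * e" using that by (intro mult_strict_mono) auto
    then show False using that by (simp add: power2_eq_square)
  qed
  have region: "{(d, e). 1 \<le> d \<and> 1 \<le> e \<and> d * e \<le> N\<^sup>2} = Box \<union> (Up \<union> Right)" (is "?R = _")
  proof (rule Set.set_eqI)
    fix z :: "nat \<times> nat"
    obtain d e where z: "z = (d, e)" by fastforce
    have "d * e \<le> N\<^sup>2" if "d \<le> N" "e \<le> N"
      using that by (simp add: power2_eq_square mult_mono)
    then show "z \<in> ?R \<longleftrightarrow> z \<in> Box \<union> (Up \<union> Right)"
      using large[of d e] by (auto simp: z Right_iff Up_iff Box_def mult.commute)
  qed
  have "(\<Sum>n\<in>{1..N\<^sup>2}. dirichlet_convolution f g n / sqrt n)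
      = (\<Sum>n\<in>{1..N\<^sup>2}. \<Sum>d | d dvd n. h (d, n div d))"
  proof (rule sum.cong[OF refl])
    fix n assume "n \<in> {1..N\<^sup>2}"
    then have "n > 0" by simp
    show "dirichlet_convolution f g n / sqrt n = (\<Sum>d | d dvd n. h (d, n div d))"
      unfolding dirichlet_convolution_def sum_divide_distrib
    proof (rule sum.cong[OF refl], clarify)
      fix d assume "d dvd n"
      then obtain e where n: "n = d * e" ..
      with \<open>n > 0\<close> show "f d * g (n div d) / sqrt n = h (d, n div d)"
        by (simp add: h_def real_sqrt_mult)
    qed
  qed
  also have "\<dots> = (\<Sum>(n, d)\<in>Sigma {1..N\<^sup>2} (\<lambda>n. {d. d dvd n}). h (d, n div d))"
    by (rule sum.Sigma) auto
  also have "\<dots> = sum h ?R"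
    by (rule sum.reindex_bij_witness[where i = "\<lambda>(d, e). (d * e, d)" and j = "\<lambda>(n, d). (d, n div d)"])
      (auto simp: dvd_pos_nat Suc_le_eq dest: dvd_imp_le intro!: Nat.gr0I)
  also have "\<dots> = sum h Box + (sum h Up + sum h Right)"
  proof -
    have "Up \<inter> Right = {}" "Box \<inter> (Up \<union> Right) = {}"
      by (auto simp: Box_def Right_iff Up_iff)
    then show ?thesis unfolding region using fin by (simp add: sum.union_disjoint)
  qed
  finally have split: "(\<Sum>n\<in>{1..N\<^sup>2}. dirichlet_convolution f g n / sqrt n)
      = sum h Box + (sum h Up + sum h Right)" .
  have "sum h Box = (\<Sum>d\<in>{1..<Suc N}. f d / sqrt d) * (\<Sum>e\<in>{1..<Suc N}. g e / sqrt e)"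
    unfolding Box_def h_def sum_product sum.cartesian_product by simp
  moreover have "\<bar>\<Sum>d\<in>{1..<Suc N}. f d / sqrt d\<bar> \<le> 2 * B"
    using abs_sum_over_sqrt_le[OF f, of 1 "Suc N"] by simp
  moreover have "\<bar>\<Sum>d\<in>{1..<Suc N}. g d / sqrt d\<bar> \<le> 2 * B"
    using abs_sum_over_sqrt_le[OF g, of 1 "Suc N"] by simp
  ultimately have "\<bar>sum h Box\<bar> \<le> 2 * B * (2 * B)"
    by (simp only: abs_mult) (rule mult_mono, assumption+, simp_all add: B)
  moreover have "\<bar>sum h Up\<bar> \<le> 4 * B"
  proof -
    have Up_sum: "sum h Up = (\<Sum>d\<in>{1..<Suc N}. f d / sqrt d * (\<Sum>e\<in>{Suc N..<Suc (N\<^sup>2 div d)}. g e / sqrt e))"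
      unfolding Up_def h_def sum_distrib_left by (rule sum.Sigma[symmetric]) auto
    show ?thesis unfolding Up_sum by (rule abs_hyperbola_wing_le[OF f1 g])
  qed
  moreover have "\<bar>sum h Right\<bar> \<le> 4 * B"
  proof -
    have "sum h Right = (\<Sum>(d, e)\<in>Up. g d / sqrt d * (f e / sqrt e))"
      unfolding Right_def
      by (subst sum.reindex) (auto simp: h_def case_prod_unfold mult.commute intro!: sum.cong)
    also have "\<dots> = (\<Sum>d\<in>{1..<Suc N}. g d / sqrt d * (\<Sum>e\<in>{Suc N..<Suc (N\<^sup>2 div d)}. f e / sqrt e))"
      unfolding Up_def sum_distrib_left by (rule sum.Sigma[symmetric]) auto
    finally show ?thesis by (simp only: abs_hyperbola_wing_le[OF g1 f])
  qed
  ultimately show ?thesis unfolding split by (simp add: power2_eq_square)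
qed

section \<open>Two quadratic characters have a common prime of value -1\<close>

text \<open>
  The local Euler factor at \<open>p\<close> splits off, because every divisor of \<open>p ^ k * r\<close> is uniquely \<open>p ^ i * d\<close>
  with \<open>i \<le> k\<close> and \<open>d\<close> a divisor of \<open>r\<close>.
\<close>

lemma dirichlet_convolution_prime_power_mult:
  fixes f g :: "nat \<Rightarrow> 'a :: comm_semiring_1"
  assumes f: "\<And>m n. f (m * n) = f m * f n" "f 1 = 1"
    and g: "\<And>m n. g (m * n) = g m * g n" "g 1 = 1"
    and p: "prime p" "\<not> p dvd r" "r > 0"
  shows "dirichlet_convolution f g (p ^ k * r)
    = (\<Sum>i\<le>k. f p ^ i * g p ^ (k - i)) * dirichlet_convolution f g r"
proof -
  have pow: "f (p ^ i) = f p ^ i" "g (p ^ i) = g p ^ i" for i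
    by (induction i) (use f g in simp_all)
  have "dirichlet_convolution f g (p ^ k * r)
      = (\<Sum>(i, d)\<in>{..k} \<times> {d. d dvd r}. f p ^ i * g p ^ (k - i) * (f d * g (r div d)))"
    unfolding dirichlet_convolution_def
  proof (rule sum.reindex_bij_betw[symmetric, THEN trans])
    show "bij_betw (\<lambda>(i, d). p ^ i * d) ({..k} \<times> {d. d dvd r}) {d. d dvd p ^ k * r}"
    proof (rule bij_betwI')
      fix x y :: "nat \<times> nat"
      assume xy: "x \<in> {..k} \<times> {d. d dvd r}" "y \<in> {..k} \<times> {d. d dvd r}"
      obtain i d j e where eq: "x = (i, d)" "y = (j, e)" by fastforce
      have nd: "\<not> p dvd d" "\<not> p dvd e" using xy p(2) eq by (auto dest: dvd_trans)
      then have nz: "d \<noteq> 0" "e \<noteq> 0" by (metis dvd_0_right)+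
      have "i = j \<and> d = e" if "p ^ i * d = p ^ j * e"
      proof -
        have "multiplicity p (p ^ i * d) = i" "multiplicity p (p ^ j * e) = j"
          \<comment> \<open>The exponent is recovered from the product as the multiplicity of \<open>p\<close>.\<close>
          using nd p(1) nz by (simp_all add: prime_elem_multiplicity_mult_distrib not_dvd_imp_multiplicity_0)
        then have "i = j" using that by simp
        with that p(1) show ?thesis by (simp add: prime_gt_0_nat)
      qed
      then show "(case x of (i, d) \<Rightarrow> p ^ i * d) = (case y of (i, d) \<Rightarrow> p ^ i * d) \<longleftrightarrow> x = y"
        using eq by auto
    next
      fix x :: "nat \<times> nat" assume "x \<in> {..k} \<times> {d. d dvd r}"
      then show "(case x of (i, d) \<Rightarrow> p ^ i * d) \<in> {d. d dvd p ^ k * r}"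
        by (auto intro!: mult_dvd_mono le_imp_power_dvd)
    next
      fix n assume "n \<in> {d. d dvd p ^ k * r}"
      then obtain a d where n: "n = a * d" "a dvd p ^ k" "d dvd r"
        using division_decomp[of n "p ^ k" r] by auto
      obtain i where "i \<le> k" "a = p ^ i"
        using n(2) divides_primepow_nat[OF p(1)] by blast
      with n show "\<exists>x\<in>{..k} \<times> {d. d dvd r}. n = (case x of (i, d) \<Rightarrow> p ^ i * d)"
        by (intro bexI[of _ "(i, d)"]) simp_all
    qed
  next
    show "(\<Sum>x\<in>{..k} \<times> {d. d dvd r}. f (case x of (i, d) \<Rightarrow> p ^ i * d) *
          g (p ^ k * r div (case x of (i, d) \<Rightarrow> p ^ i * d)))
        = (\<Sum>(i, d)\<in>{..k} \<times> {d. d dvd r}. f p ^ i * g p ^ (k - i) * (f d * g (r div d)))"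
    proof (rule sum.cong[OF refl])
      fix x assume "x \<in> {..k} \<times> {d. d dvd r}"
      then obtain i d where x: "x = (i, d)" "i \<le> k" "d dvd r" by auto
      then have "p ^ k * r div (p ^ i * d) = p ^ (k - i) * (r div d)"
        using p(1) by (simp add: le_imp_power_dvd power_diff prime_gt_0_nat flip: div_mult_div_if_dvd)
      then show "f (case x of (i, d) \<Rightarrow> p ^ i * d) * g (p ^ k * r div (case x of (i, d) \<Rightarrow> p ^ i * d))
          = (case x of (i, d) \<Rightarrow> f p ^ i * g p ^ (k - i) * (f d * g (r div d)))"
        by (simp add: x f g pow mult_ac)
    qed
  qed
  then show ?thesis
    by (simp add: dirichlet_convolution_def sum_product sum.cartesian_product)
qed

text \<open>
  If one of two signs is 1, the Euler factor is \<open>k + 1\<close> or an alternating sum \<open>1 - 1 + 1 - \<dots>\<close>, possibly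
  read backwards. Only when both signs are -1 and \<open>k\<close> is odd can it be negative.
\<close>

lemma signed_geometric_sum:
  fixes x y :: int
  assumes "x \<in> {-1, 0, 1}" "y \<in> {-1, 0, 1}" "x = 0 \<longleftrightarrow> y = 0" "\<not> (x = -1 \<and> y = -1)"
  shows "(\<Sum>i\<le>k. x ^ i * y ^ (k - i)) \<ge> 0"
    and "even k \<Longrightarrow> x \<noteq> 0 \<Longrightarrow> (\<Sum>i\<le>k. x ^ i * y ^ (k - i)) \<ge> 1"
proof -
  have alt: "(\<Sum>i\<le>k. (-1 :: int) ^ i) = (if even k then 1 else 0)"
    by (induction k) auto
  have rev: "(\<Sum>i\<le>k. (-1 :: int) ^ (k - i)) = (\<Sum>i\<le>k. (-1) ^ i)"
    by (rule sum.reindex_bij_witness[where i = "\<lambda>i. k - i" and j = "\<lambda>i. k - i"]) auto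
  have zero: "(\<Sum>i\<le>k. (0 :: int) ^ i * 0 ^ (k - i)) \<ge> 0"
    by (intro sum_nonneg) auto
  show "(\<Sum>i\<le>k. x ^ i * y ^ (k - i)) \<ge> 0"
    using assms zero by (auto simp: alt rev)
  show "(\<Sum>i\<le>k. x ^ i * y ^ (k - i)) \<ge> 1" if "even k" "x \<noteq> 0"
    using assms that by (auto simp: alt rev)
qed

text \<open>
  A nonprincipal real Dirichlet character of modulus \<open>M\<close>, on the natural numbers.
\<close>

locale quadratic_character =
  fixes M :: nat and f :: "nat \<Rightarrow> int"
  assumes modulus: "M > 1"
    and periodic: "f (n + M) = f n"
    and mult: "f (m * n) = f m * f n"
    and sign: "coprime n M \<Longrightarrow> f n \<in> {-1, 1}"
    and zero: "\<not> coprime n M \<Longrightarrow> f n = 0"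
    and nontrivial: "\<exists>n. f n = -1"
begin

lemma sign_or_zero: "f n \<in> {-1, 0, 1}"
  using sign[of n] zero[of n] by auto

lemma eq_0_iff: "f n = 0 \<longleftrightarrow> \<not> coprime n M"
  using sign[of n] zero[of n] by auto

lemma one: "f 1 = 1"
  using mult[of 1 1] sign[of 1] by auto

lemma periodic_mult: "f (n + M * k) = f n"
proof (induction k)
  case (Suc k)
  then show ?case using periodic[of "n + M * k"] by (simp add: ac_simps)
qed simp

lemma mod_modulus: "f (n mod M) = f n"
  using periodic_mult[of "n mod M" "n div M"] by simp

text \<open>
  Multiplication by some \<open>c\<close> with \<open>f c = -1\<close> permutes the residue classes and changes the sign of the sum.
\<close>

lemma sum_period: "(\<Sum>n<M. f n) = 0"
proof -
  obtain c where c: "f c = -1" using nontrivial by blast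
  then have cop: "coprime c M" using zero by force
  have "inj_on (\<lambda>n. c * n mod M) {..<M}"
  proof (rule inj_onI)
    fix x y assume xy: "x \<in> {..<M}" "y \<in> {..<M}" "c * x mod M = c * y mod M"
    then have "[x = y] (mod M)"
      using cong_mult_lcancel_nat[OF cop] by (simp add: cong_def)
    with xy show "x = y" by (simp add: cong_def)
  qed
  moreover have "(\<lambda>n. c * n mod M) ` {..<M} \<subseteq> {..<M}" using modulus by auto
  ultimately have "bij_betw (\<lambda>n. c * n mod M) {..<M} {..<M}"
    by (simp add: bij_betw_def endo_inj_surj)
  then have "(\<Sum>n<M. f n) = (\<Sum>n<M. f (c * n mod M))"
    by (rule sum.reindex_bij_betw[symmetric])
  also have "\<dots> = (\<Sum>n<M. f (c * n))" by (simp only: mod_modulus)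
  also have "\<dots> = - (\<Sum>n<M. f n)" by (simp add: mult c sum_negf)
  finally show ?thesis by simp
qed

lemma abs_partial_sum_le: "\<bar>\<Sum>n<N. f n\<bar> \<le> int M"
proof -
  have split: "(\<Sum>n<a + b. f n) = (\<Sum>n<a. f n) + (\<Sum>n<b. f (a + n))" for a b
    by (induction b) (simp_all add: add.assoc)
  have "(\<Sum>n<M * k. f n) = 0" for k
  proof (induction k)
    case (Suc k)
    have "(\<Sum>n<M. f (M * k + n)) = 0"
      using periodic_mult by (simp add: add.commute sum_period)
    then show ?case using Suc.IH split[of "M * k" M] by (simp add: add.commute)
  qed simp
  then have "(\<Sum>n<M * (N div M) + N mod M. f n) = (\<Sum>n<N mod M. f (M * (N div M) + n))"
    unfolding split by simp
  then have "\<bar>\<Sum>n<N. f n\<bar> \<le> (\<Sum>n<N mod M. \<bar>f (M * (N div M) + n)\<bar>)"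
    by simp
  also have "\<dots> \<le> (\<Sum>n<N mod M. 1)"
    using sign_or_zero by (intro sum_mono) (metis abs_0 abs_1 abs_neg_one insert_iff order.refl singletonD zero_le_one)
  also have "\<dots> \<le> int M" using modulus by (simp add: less_imp_le)
  finally show ?thesis .
qed

end

text \<open>
  The assumption to be refuted: no prime takes the value -1 under both characters. With a common
  modulus both characters vanish at the same primes, so every Euler factor of their convolution
  falls under the sign analysis above.
\<close>

locale quadratic_character_pair =
  f: quadratic_character M f + g: quadratic_character M g for M f g +
  assumes never_both: "prime p \<Longrightarrow> \<not> (f p = -1 \<and> g p = -1)"
begin

text \<open>
  Each Euler factor is nonnegative, and it is at least 1 at a prime that divides \<open>n\<close> to an even power and
  does not divide \<open>M\<close>. Induction on \<open>n\<close> strips off one prime power at a time.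
\<close>

lemma convolution_nonneg:
  assumes "n > 0"
  shows "dirichlet_convolution f g n \<ge> 0"
    and "is_square n \<Longrightarrow> coprime n M \<Longrightarrow> dirichlet_convolution f g n \<ge> 1"
proof -
  have "dirichlet_convolution f g n \<ge> 0 \<and>
    (is_square n \<longrightarrow> coprime n M \<longrightarrow> dirichlet_convolution f g n \<ge> 1)"
    using assms
  proof (induction n rule: less_induct)
    case (less n)
    show ?case
    proof (cases "n = 1")
      case True
      then show ?thesis
        using f.one g.one by (simp add: dirichlet_convolution_def)
    next
      case False
      then obtain p where p: "prime p" "p dvd n" using prime_factor_nat by blast
      define k where "k = multiplicity p n"
      obtain r where r: "n = p ^ k * r" "\<not> p dvd r"
      proof (rule multiplicity_decompose'[of n p])
        show "n \<noteq> 0" "\<not> is_unit p" using less.prems p(1) by auto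
      qed (use that in \<open>simp add: k_def mult.commute\<close>)
      have "r > 0" using r(2) by (rule_tac Nat.gr0I) auto
      have "k > 0" using p less.prems unfolding k_def by (simp add: prime_multiplicity_gt_zero_iff)
      have "r < n"
      proof -
        have "1 < p ^ k" by (rule one_less_power[OF prime_gt_1_nat[OF p(1)] \<open>k > 0\<close>])
        then show ?thesis using r(1) \<open>r > 0\<close> by simp
      qed
      note IH = less.IH[OF this \<open>r > 0\<close>]
      have cop: "coprime (p ^ k) r"
        using p(1) r(2) by (simp add: prime_imp_coprime)
      have conv: "dirichlet_convolution f g n
          = (\<Sum>i\<le>k. f p ^ i * g p ^ (k - i)) * dirichlet_convolution f g r"
        unfolding r(1) using f.mult f.one g.mult g.one p(1) r(2) \<open>r > 0\<close>
        by (rule dirichlet_convolution_prime_power_mult)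
      have zero_iff: "f p = 0 \<longleftrightarrow> g p = 0" by (simp add: f.eq_0_iff g.eq_0_iff)
      note factor = signed_geometric_sum[OF f.sign_or_zero g.sign_or_zero zero_iff never_both[OF p(1)], of k]
      show ?thesis
      proof (intro conjI impI)
        show "dirichlet_convolution f g n \<ge> 0" unfolding conv using factor(1) IH by simp
      next
        assume sq: "is_square n" and "coprime n M"
        then have "coprime p M" "coprime r M" using r(1) \<open>k > 0\<close> by simp_all
        have "is_square (p ^ k)" "is_square r"
          using sq unfolding r(1) is_nth_power_mult_coprime_nat_iff[OF cop] by simp_all
        then have "even k" using is_nth_power_prime_power_nat_iff[OF p(1)] by simp
        have "(\<Sum>i\<le>k. f p ^ i * g p ^ (k - i)) \<ge> 1"
          using factor(2) \<open>even k\<close> \<open>coprime p M\<close> by (simp add: f.eq_0_iff)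
        moreover have "dirichlet_convolution f g r \<ge> 1" 
          using IH \<open>is_square r\<close> \<open>coprime r M\<close> by simp
        ultimately show "dirichlet_convolution f g n \<ge> 1" unfolding conv
          using mult_mono[of 1 _ 1] by fastforce
      qed
    qed
  qed
  then show "dirichlet_convolution f g n \<ge> 0"
    and "is_square n \<Longrightarrow> coprime n M \<Longrightarrow> dirichlet_convolution f g n \<ge> 1" by auto
qed

text \<open>
  The lower bound that conflicts with the hyperbola bound: keep only the terms at the squares of the
  numbers \<open>1 + M * j\<close>, which are coprime to \<open>M\<close>. Each such term is at least
  \<open>1 / (1 + M * j)\<close>, hence at least \<open>1 / (M * (j + 1))\<close>.
\<close>

lemma convolution_sum_ge_harmonic:
  "(\<Sum>j<J. inverse (real (Suc j))) / M
    \<le> (\<Sum>n\<in>{1..(1 + M * J)\<^sup>2}. of_int (dirichlet_convolution f g n) / sqrt (real n))"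
proof -
  define s where "s = (\<lambda>j. (1 + M * j)\<^sup>2)"
  have M: "M > 0" using f.modulus by simp
  have "(\<Sum>j<J. inverse (real (Suc j))) / M = (\<Sum>j<J. 1 / (M * real (Suc j)))"
    unfolding sum_divide_distrib by (intro sum.cong) (simp_all add: field_simps)
  also have "\<dots> \<le> (\<Sum>j<J. of_int (dirichlet_convolution f g (s j)) / sqrt (s j))"
  proof (rule sum_mono)
    fix j
    have "coprime (1 + M * j) M" by (metis coprime_1_left coprime_iff_gcd_eq_1 gcd_add_mult gcd.commute mult.commute add.commute)
    then have "dirichlet_convolution f g (s j) \<ge> 1"
      by (intro convolution_nonneg) (simp_all add: s_def)
    moreover have "sqrt (s j) = 1 + M * j" by (simp add: s_def)
    moreover have "real (1 + M * j) \<le> M * real (Suc j)" using M by (simp add: algebra_simps)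
    ultimately show "1 / (M * real (Suc j)) \<le> of_int (dirichlet_convolution f g (s j)) / sqrt (s j)"
      using M by (intro frac_le) (simp_all add: add_pos_nonneg)
  qed
  also have "\<dots> = (\<Sum>n\<in>s ` {..<J}. of_int (dirichlet_convolution f g n) / sqrt (real n))"
    using M by (subst sum.reindex) (auto simp: s_def inj_on_def power2_eq_iff_nonneg)
  also have "\<dots> \<le> (\<Sum>n\<in>{1..(1 + M * J)\<^sup>2}. of_int (dirichlet_convolution f g n) / sqrt (real n))"
  proof (rule sum_mono2)
    show "s ` {..<J} \<subseteq> {1..(1 + M * J)\<^sup>2}"
      by (auto simp: s_def intro!: power_mono)
  qed (auto intro!: divide_nonneg_nonneg convolution_nonneg)
  finally show ?thesis .
qed

lemma contradiction: False
proof -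
  let ?C = "4 * (real M)\<^sup>2 + 8 * real M"
  have conv: "dirichlet_convolution (\<lambda>n. real_of_int (f n)) (\<lambda>n. real_of_int (g n)) n
      = of_int (dirichlet_convolution f g n)" for n
    by (simp add: dirichlet_convolution_def)
  have abs_f: "\<bar>real_of_int (f n)\<bar> \<le> 1" for n using f.sign_or_zero[of n] by auto
  have abs_g: "\<bar>real_of_int (g n)\<bar> \<le> 1" for n using g.sign_or_zero[of n] by auto
  have sum_f: "\<bar>\<Sum>i<n. real_of_int (f i)\<bar> \<le> real M" for n
    using f.abs_partial_sum_le[of n] by (simp flip: of_int_sum of_int_abs)
  have sum_g: "\<bar>\<Sum>i<n. real_of_int (g i)\<bar> \<le> real M" for n
    using g.abs_partial_sum_le[of n] by (simp flip: of_int_sum of_int_abs)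
  have M: "real M > 0" using f.modulus by simp
  have "(\<Sum>j<J. inverse (real (Suc j))) \<le> ?C * M" for J
  proof -
    have "(\<Sum>j<J. inverse (real (Suc j))) / M \<le> ?C"
      using convolution_sum_ge_harmonic[of J]
        abs_convolution_sum_le[OF abs_f abs_g sum_f sum_g, of "1 + M * J"]
      unfolding conv by linarith
    then show ?thesis using M by (simp add: pos_divide_le_eq)
  qed
  then have "summable (\<lambda>j. inverse (real (Suc j)))"
    by (intro summableI_nonneg_bounded[where x = "?C * M"]) auto
  then have "summable (\<lambda>n. inverse (real n))"
    by (subst (asm) summable_Suc_iff)
  then show False using not_summable_harmonic[where 'a = real] by simp
qed

end

text \<open>
  Seen through the quadratic fields that \<open>f\<close> and \<open>g\<close> describe, the prime is inert in both. Inertness in a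
  single field follows from the existence of a value -1 alone, by multiplicativity; for two fields at once
  the factors of a number could have the signs (1, -1) and (-1, 1), and it is the conflict
  between the two bounds on the convolution sum that excludes this as the only possibility.
\<close>

theorem exists_prime_both_minus_one:
  assumes "quadratic_character M f" "quadratic_character M g"
  shows "\<exists>p. prime p \<and> f p = -1 \<and> g p = -1"
proof (rule ccontr)
  assume *: "\<nexists>p. prime p \<and> f p = -1 \<and> g p = -1"
  interpret f: quadratic_character M f by fact
  interpret g: quadratic_character M g by fact
  interpret quadratic_character_pair M f g
    by unfold_locales (use * in auto)
  show False by (rule contradiction)
qed

section \<open>Legendre symbols and primes congruent to 3 modulo 4\<close>

lemma Legendre_range: "Legendre a p \<in> {-1, 0, 1}"
  by (simp add: Legendre_def)

lemma Legendre_eq_0_iff: "Legendre a p = 0 \<longleftrightarrow> p dvd a"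
  by (simp add: Legendre_def cong_0_iff)

lemma Legendre_cong:
  assumes "[a = b] (mod p)"
  shows "Legendre a p = Legendre b p"
proof -
  have "[a = 0] (mod p) \<longleftrightarrow> [b = 0] (mod p)" "QuadRes p a \<longleftrightarrow> QuadRes p b"
    using assms unfolding QuadRes_def by (meson cong_sym cong_trans)+
  then show ?thesis by (simp add: Legendre_def)
qed

text \<open>
  Identities between Legendre symbols may be checked modulo \<open>p\<close>, where Euler's criterion turns them into
  identities between powers.
\<close>

lemma sign_eq_of_cong:
  fixes x y p :: int
  assumes "[x = y] (mod p)" "p > 2" "x \<in> {-1, 0, 1}" "y \<in> {-1, 0, 1}"
  shows "x = y"
proof (rule ccontr)
  assume "x \<noteq> y"
  have "p dvd x - y" using assms(1) by (simp add: cong_iff_dvd_diff)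
  then have "\<bar>p\<bar> \<le> \<bar>x - y\<bar>" using \<open>x \<noteq> y\<close> by (intro dvd_imp_le_int) auto
  with assms show False by auto
qed

lemma Legendre_mult:
  assumes "prime p" "p > 2"
  shows "Legendre (a * b) (int p) = Legendre a (int p) * Legendre b (int p)"
proof (rule sign_eq_of_cong[of _ _ "int p"])
  let ?k = "(p - 1) div 2"
  have "[Legendre (a * b) p = (a * b) ^ ?k] (mod p)"
    using assms by (rule euler_criterion)
  also have "(a * b) ^ ?k = a ^ ?k * b ^ ?k" by (rule power_mult_distrib)
  also have "[a ^ ?k * b ^ ?k = Legendre a p * Legendre b p] (mod p)"
    using assms by (intro cong_mult cong_sym[OF euler_criterion])
  finally show "[Legendre (a * b) p = Legendre a p * Legendre b p] (mod p)" .
  show "Legendre a p * Legendre b p \<in> {-1, 0, 1}"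
    using Legendre_range[of a p] Legendre_range[of b p] by auto
qed (use assms Legendre_range in auto)

lemma Legendre_square:
  assumes "\<not> p dvd x" "prime p"
  shows "Legendre (x\<^sup>2) p = 1"
proof -
  have "QuadRes p (x\<^sup>2)" unfolding QuadRes_def using cong_refl by blast
  then show ?thesis using assms by (auto simp: Legendre_def cong_0_iff prime_dvd_power_iff)
qed

text \<open>
  If every nonzero class were a square, squaring would be a surjection, hence an injection, on the
  nonzero classes; but 1 and -1 have the same square.
\<close>

lemma exists_nonresidue:
  assumes "prime q" "q > 2"
  shows "\<exists>u::nat. Legendre (int u) (int q) = -1"
proof (rule ccontr)
  assume none: "\<nexists>u::nat. Legendre (int u) (int q) = -1"
  define sq where "sq = (\<lambda>y::nat. y\<^sup>2 mod q)"
  have "{1..<q} \<subseteq> sq ` {1..<q}"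
  proof
    fix u assume u: "u \<in> {1..<q}"
    then have "\<not> [int u = 0] (mod int q)"
      by (auto simp: cong_0_iff dest: dvd_imp_le)
    then have "QuadRes (int q) (int u)"
      using none unfolding Legendre_def by (metis)
    then obtain y :: int where y: "[y\<^sup>2 = int u] (mod int q)" by (auto simp: QuadRes_def)
    define z where "z = nat (y mod int q)"
    have q: "int q > 0" using assms by simp
    have z: "int z = y mod int q" "z < q" using q by (simp_all add: z_def nat_less_iff)
    have "int (z\<^sup>2 mod q) = int u mod int q"
      using y by (simp add: z zmod_int power_mod cong_def)
    also have "\<dots> = int u" using u by simp
    finally have "sq z = u" unfolding sq_def by simp
    moreover have "z \<noteq> 0" using \<open>sq z = u\<close> u by (cases "z = 0") (simp_all add: sq_def)
    ultimately show "u \<in> sq ` {1..<q}" using z(2) by force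
  qed
  then have "card {1..<q} \<le> card (sq ` {1..<q})" by (intro card_mono) simp_all
  then have "inj_on sq {1..<q}"
    using card_image_le[of "{1..<q}" sq] by (intro eq_card_imp_inj_on) simp_all
  moreover have "sq 1 = sq (q - 1)"
  proof -
    have "[(int q - 1)\<^sup>2 = 1] (mod int q)"
      by (simp add: cong_iff_dvd_diff power2_eq_square algebra_simps)
    then have "int ((q - 1)\<^sup>2 mod q) = int (1 mod q)"
      using assms(2) by (simp add: zmod_int of_nat_diff cong_def)
    then show ?thesis using assms(2) by (simp add: sq_def)
  qed
  ultimately have "1 = q - 1" using assms(2) by (auto dest: inj_onD)
  with assms(2) show False by simp
qed

text \<open>
  A product of primes that are all 1 modulo 4 is itself 1 modulo 4.
\<close>

lemma exists_prime_factor_3_mod_4: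
  fixes N :: nat
  assumes "N mod 4 = 3"
  shows "\<exists>p. prime p \<and> p mod 4 = 3 \<and> p dvd N"
  using assms
proof (induction N rule: less_induct)
  case (less N)
  have "N \<noteq> 1" using less.prems by auto
  then obtain p where p: "prime p" "p dvd N" using prime_factor_nat by blast
  then obtain r where r: "N = p * r" by auto
  have odd: "odd p" "odd r"
  proof -
    have "odd N" using less.prems by presburger
    then show "odd p" "odd r" using r by simp_all
  qed
  show ?case
  proof (cases "p mod 4 = 3")
    case False
    then have "p mod 4 = 1" using odd by presburger
    then have "r mod 4 = 3" using less.prems r mod_mult_left_eq[of p 4 r] by simp
    moreover have "r < N" using r prime_gt_1_nat[OF p(1)] less.prems by (cases "r = 0") auto
    ultimately obtain p' where "prime p'" "p' mod 4 = 3" "p' dvd r" using less.IH by blast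
    then show ?thesis using r dvd_mult by blast
  next
    case True
    then show ?thesis using p by blast
  qed
qed

lemma odd_half_of_3_mod_4:
  fixes p :: nat
  assumes "p mod 4 = 3"
  shows "odd ((p - 1) div 2)" "p > 2"
  using assms by presburger+

lemma Legendre_minus_one:
  assumes "prime p" "p mod 4 = 3"
  shows "Legendre (-1) (int p) = -1"
proof (rule sign_eq_of_cong[of _ _ "int p"])
  show "[Legendre (-1) (int p) = -1] (mod int p)"
    using euler_criterion[of p "-1"] assms odd_half_of_3_mod_4[of p] by simp
qed (use assms Legendre_range odd_half_of_3_mod_4 in auto)

text \<open>
  Modulo \<open>p\<close>, \<open>a\<close> is -1 times a nonzero square, and -1 is a nonresidue when \<open>p\<close> is 3 modulo 4.
\<close>

lemma Legendre_eq_minus_one_if_dvd: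
  assumes p: "prime p" "p mod 4 = 3" and dvd: "int p dvd x\<^sup>2 + a" and x: "\<not> int p dvd x"
  shows "Legendre a (int p) = -1"
proof -
  have "[a = -1 * x\<^sup>2] (mod int p)"
    using dvd by (simp add: cong_iff_dvd_diff add.commute)
  then have "Legendre a p = Legendre (-1) p * Legendre (x\<^sup>2) p"
    using Legendre_mult[OF p(1) odd_half_of_3_mod_4(2)[OF p(2)], of "-1" "x\<^sup>2"] Legendre_cong by simp
  then show ?thesis using Legendre_minus_one[OF p] Legendre_square[OF x] p(1) by simp
qed

section \<open>The Jacobi symbol\<close>

text \<open>
  The Jacobi symbol when \<open>b\<close> is odd.
\<close>

definition jacobi :: "nat \<Rightarrow> nat \<Rightarrow> int" where
  "jacobi n b = (\<Prod>q\<in>#prime_factorization b. Legendre (int n) (int q))"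

lemma jacobi_mult_right:
  assumes "a > 0" "b > 0"
  shows "jacobi n (a * b) = jacobi n a * jacobi n b"
  using assms by (simp add: jacobi_def prime_factorization_mult)

lemma odd_prime_factor_gt_2:
  fixes b q :: nat
  assumes "odd b" "q \<in># prime_factorization b"
  shows "prime q" "q > 2" "q dvd b"
proof -
  show "prime q" "q dvd b" using assms(2) by (auto dest: in_prime_factors_imp_prime in_prime_factors_imp_dvd)
  then have "q \<noteq> 2" "q \<ge> 2" using assms(1) by (auto simp: prime_ge_2_nat)
  then show "q > 2" by simp
qed

lemma jacobi_mult_left:
  assumes "odd b"
  shows "jacobi (m * n) b = jacobi m b * jacobi n b"
proof -
  have "jacobi (m * n) b
      = (\<Prod>q\<in>#prime_factorization b. Legendre (int m) (int q) * Legendre (int n) (int q))"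
    unfolding jacobi_def
    using odd_prime_factor_gt_2[OF assms] by (intro arg_cong[where f = prod_mset] image_mset_cong) (simp add: Legendre_mult)
  then show ?thesis by (simp add: jacobi_def prod_mset.distrib)
qed

lemma jacobi_cong:
  assumes "[m = n] (mod b)"
  shows "jacobi m b = jacobi n b"
  unfolding jacobi_def
proof (intro arg_cong[where f = prod_mset] image_mset_cong Legendre_cong)
  fix q assume "q \<in># prime_factorization b"
  then have "q dvd b" by (rule in_prime_factors_imp_dvd)
  then show "[int m = int n] (mod int q)"
    using cong_dvd_modulus_nat[OF assms] by (simp add: cong_int_iff)
qed

lemma jacobi_range: "jacobi n b \<in> {-1, 0, 1}"
proof -
  have "(\<Prod>q\<in>#A. Legendre (int n) (int q)) \<in> {-1, 0, 1}" for A
  proof (induction A)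
    case (add q A)
    then show ?case using Legendre_range[of "int n" "int q"] by auto
  qed simp
  then show ?thesis by (simp add: jacobi_def)
qed

lemma jacobi_eq_0_iff:
  assumes "b > 0"
  shows "jacobi n b = 0 \<longleftrightarrow> \<not> coprime n b"
proof -
  have "jacobi n b = 0 \<longleftrightarrow> (\<exists>q\<in>#prime_factorization b. q dvd n)"
    by (auto simp: jacobi_def Legendre_eq_0_iff)
  also have "\<dots> \<longleftrightarrow> (\<exists>q. prime q \<and> q dvd b \<and> q dvd n)"
    using assms by (auto simp: in_prime_factors_iff)
  also have "\<dots> \<longleftrightarrow> \<not> coprime n b"
  proof
    assume "\<exists>q. prime q \<and> q dvd b \<and> q dvd n"
    then show "\<not> coprime n b" using coprime_common_divisor not_prime_unit by blast
  next
    assume "\<not> coprime n b"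
    then have "gcd n b \<noteq> 1" by (metis coprime_iff_gcd_eq_1)
    then obtain q where "prime q" "q dvd gcd n b" using prime_factor_nat by blast
    then have "prime q \<and> q dvd b \<and> q dvd n" by (simp only: gcd_greatest_iff)
    then show "\<exists>q. prime q \<and> q dvd b \<and> q dvd n" ..
  qed
  finally show ?thesis .
qed

lemma jacobi_prime_power:
  assumes "prime q"
  shows "jacobi n (q ^ k) = Legendre (int n) (int q) ^ k"
  using assms by (simp add: jacobi_def prime_factorization_prime_power)

lemma jacobi_one_left: "odd b \<Longrightarrow> jacobi 1 b = 1"
  using jacobi_mult_left[of b 1 1] jacobi_eq_0_iff[of b 1] odd_pos[of b] by simp

text \<open>
  Since \<open>(p - 1) div 2\<close> is odd, the sign in quadratic reciprocity depends only on \<open>q\<close>. The sign is the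
  character modulo 4 evaluated at \<open>q\<close>; it is therefore multiplicative in \<open>q\<close>, which lets the reciprocity
  law pass from \<open>q\<close> to odd composite numbers in the next lemma.
\<close>

lemma Legendre_swap_3_mod_4:
  assumes p: "prime p" "p mod 4 = 3" and q: "prime q" "q > 2" "q \<noteq> p"
  shows "Legendre (int p) (int q) = Legendre (int q) (int p) * (if q mod 4 = 1 then 1 else -1)"
proof -
  have "odd q" using q prime_odd_nat by blast
  then have "even ((q - 1) div 2) \<longleftrightarrow> q mod 4 = 1" by presburger
  then have product: "Legendre p q * Legendre q p = (if q mod 4 = 1 then 1 else -1)"
    using Quadratic_Reciprocity[OF p(1) _ q(1,2)] q(3) odd_half_of_3_mod_4[OF p(2)]
    by (auto simp: even_mult_iff)
  have sign: "x = y * s" if "x * y = s" "y \<in> {-1, 0, 1}" "s \<noteq> 0" for x y s :: int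
    using that by auto
  show ?thesis
    by (rule sign[OF product Legendre_range]) simp
qed

lemma jacobi_prime_3_mod_4:
  assumes p: "prime p" "p mod 4 = 3" and b: "odd b" "\<not> p dvd b"
  shows "jacobi p b = Legendre (int b) (int p) * (if b mod 4 = 1 then 1 else -1)"
  using b
proof (induction b rule: less_induct)
  case (less b)
  note p2 = odd_half_of_3_mod_4(2)[OF p(2)]
  show ?case
  proof (cases "b = 1")
    case True
    have "Legendre 1 (int p) = 1"
      using Legendre_square[of "int p" 1] p by simp
    then show ?thesis using True by (simp add: jacobi_def)
  next
    case False
    then obtain q where q: "prime q" "q dvd b" using prime_factor_nat by blast
    then obtain r where r: "b = q * r" by auto
    have odd: "odd q" "odd r" and ndvd: "\<not> p dvd r" "q \<noteq> p" using less.prems r by auto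
    have pos: "q > 0" "r > 0" using odd odd_pos by auto
    have "r < b" using r pos prime_gt_1_nat[OF q(1)] by simp
    note IH = less.IH[OF this odd(2) ndvd(1)]
    have "q > 2" using odd(1) prime_ge_2_nat[OF q(1)] by (cases "q = 2") auto
    have "jacobi p b = Legendre (int p) (int q) * jacobi p r"
      using jacobi_mult_right[OF pos, of p] jacobi_prime_power[OF q(1), of p 1] r by simp
    also have "\<dots> = Legendre (int q) p * Legendre (int r) p
        * ((if q mod 4 = 1 then 1 else -1) * (if r mod 4 = 1 then 1 else -1))"
      unfolding IH Legendre_swap_3_mod_4[OF p q(1) \<open>q > 2\<close> ndvd(2)] by simp
    also have "Legendre (int q) p * Legendre (int r) p = Legendre (int b) p"
      using Legendre_mult[OF p(1) p2, of q r] r by simp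
    also have "((if q mod 4 = 1 then 1 else -1) * (if r mod 4 = 1 then 1 else -1))
        = (if b mod 4 = 1 then 1 else (-1 :: int))"
    proof -
      have "q mod 4 = 1 \<or> q mod 4 = 3" "r mod 4 = 1 \<or> r mod 4 = 3" using odd by presburger+
      then show ?thesis using mod_mult_eq[of q 4 r] r by auto
    qed
    finally show ?thesis .
  qed
qed

text \<open>
  A nonsquare \<open>b\<close> contains some prime \<open>q\<close> to an odd power. By the Chinese remainder theorem there is an
  odd \<open>n\<close> that is a nonresidue modulo \<open>q\<close> and is 1 modulo the rest of \<open>b\<close>; only the factors at \<open>q\<close>
  contribute a sign.
\<close>

lemma exists_jacobi_minus_one:
  assumes "odd b" "\<not> is_square b"
  shows "\<exists>n. odd n \<and> jacobi n b = -1"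
proof -
  obtain q where q: "prime q" "odd (multiplicity q b)"
    using assms(2) is_nth_power_conv_multiplicity_nat[of 2 b] by auto
  define k where "k = multiplicity q b"
  have "b \<noteq> 0" using assms(1) by (cases "b = 0") auto
  obtain r where r: "b = q ^ k * r" "\<not> q dvd r"
  proof (rule multiplicity_decompose'[of b q])
    show "b \<noteq> 0" "\<not> is_unit q" using \<open>b \<noteq> 0\<close> q(1) by auto
  qed (use that in \<open>simp add: k_def mult.commute\<close>)
  have "k > 0" using q(2) by (auto simp: k_def intro!: Nat.gr0I)
  then have "odd q" "odd r" using assms(1) r(1) by auto
  have "q > 2" using \<open>odd q\<close> prime_ge_2_nat[OF q(1)] by (cases "q = 2") auto
  obtain u where u: "Legendre (int u) (int q) = -1"
    using exists_nonresidue[OF q(1) \<open>q > 2\<close>] by blast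
  have "coprime q (2 * r)"
    using q(1) r(2) \<open>q > 2\<close> \<open>odd q\<close> by (simp add: prime_imp_coprime)
  then obtain n where n: "[n = u] (mod q)" "[n = 1] (mod 2 * r)"
    using binary_chinese_remainder_nat by blast
  have "odd n" using n(2) by (metis cong_dvd_iff cong_dvd_modulus_nat dvd_triv_left odd_one)
  have "[n = 1] (mod r)" using n(2) by (rule cong_dvd_modulus_nat) simp
  then have "jacobi n r = 1" using jacobi_cong jacobi_one_left[OF \<open>odd r\<close>] by metis
  moreover have "Legendre (int n) (int q) = -1"
    using u n(1) Legendre_cong by (metis cong_int_iff)
  ultimately have "jacobi n b = -1"
    using r(1) jacobi_mult_right[of "q ^ k" r n] jacobi_prime_power[OF q(1), of n k]
      odd_pos[OF \<open>odd r\<close>] q k_def prime_gt_0_nat by simp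
  with \<open>odd n\<close> show ?thesis by blast
qed

section \<open>Nonresidues modulo primes congruent to 3 modulo 4\<close>

lemma coprime_4_iff_odd: "coprime n (4 :: nat) \<longleftrightarrow> odd n"
  using coprime_power_right_iff[of n 2 2] by simp

text \<open>
  The nonprincipal character modulo 4, restricted to numbers coprime to \<open>b\<close> so that it shares the
  modulus \<open>4 * b\<close> with the Jacobi symbol below.
\<close>

lemma quadratic_character_mod_4:
  assumes "b > 0"
  shows "quadratic_character (4 * b)
    (\<lambda>n. if coprime n (4 * b) then if n mod 4 = 1 then 1 else -1 else 0)"
proof
  have odd: "n mod 4 = 1 \<or> n mod 4 = 3" if "coprime n (4 * b)" for n
  proof -
    have "odd n" using that by (simp add: coprime_4_iff_odd)
    then show ?thesis by presburger
  qed
  fix m n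
  show "4 * b > 1" using assms by simp
  have "gcd (n + 4 * b) (4 * b) = gcd n (4 * b)" by (rule gcd_add1)
  then have "coprime (n + 4 * b) (4 * b) \<longleftrightarrow> coprime n (4 * b)" by (metis coprime_iff_gcd_eq_1)
  then show "(if coprime (n + 4 * b) (4 * b) then if (n + 4 * b) mod 4 = 1 then 1 else -1 else 0)
      = (if coprime n (4 * b) then if n mod 4 = 1 then 1 else -1 else (0::int))"
    by simp
  show "(if coprime (m * n) (4 * b) then if (m * n) mod 4 = 1 then 1 else -1 else (0::int))
      = (if coprime m (4 * b) then if m mod 4 = 1 then 1 else -1 else 0)
        * (if coprime n (4 * b) then if n mod 4 = 1 then 1 else -1 else 0)"
  proof (cases "coprime m (4 * b) \<and> coprime n (4 * b)")
    case True
    then show ?thesis using odd[of m] odd[of n] mod_mult_eq[of m 4 n] by auto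
  qed auto
  \<comment> \<open>The class of -1 modulo \<open>4 * b\<close>, with representative \<open>4 * b - 1 = 4 * j + 3\<close>, has value -1.\<close>
  obtain j where j: "4 * b = Suc (4 * j + 3)"
  proof -
    obtain j where "b = Suc j" using assms gr0_conv_Suc by blast
    then show ?thesis using that[of j] by simp
  qed
  have "coprime (4 * j + 3) (4 * b)"
    unfolding j by (rule coprime_Suc_right_nat)
  moreover have "(4 * j + 3) mod 4 = 3" by simp
  ultimately have "(if coprime (4 * j + 3) (4 * b) then if (4 * j + 3) mod 4 = 1 then 1 else -1 else 0) = (-1::int)"
    by (simp only: if_True) simp
  then show "\<exists>n. (if coprime n (4 * b) then if n mod 4 = 1 then 1 else -1 else 0) = (-1::int)"
    by (rule exI)
qed auto

lemma quadratic_character_jacobi: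
  assumes "odd b" "\<not> is_square b"
  shows "quadratic_character (4 * b) (\<lambda>n. if odd n then jacobi n b else 0)"
proof
  have b: "b > 0" using assms(1) odd_pos by blast
  fix m n
  show "4 * b > 1" using b by simp
  have "[n + 4 * b = n] (mod b)" by (simp add: cong_def)
  then show "(if odd (n + 4 * b) then jacobi (n + 4 * b) b else 0) = (if odd n then jacobi n b else 0)"
    using jacobi_cong by simp
  show "(if odd (m * n) then jacobi (m * n) b else 0)
      = (if odd m then jacobi m b else 0) * (if odd n then jacobi n b else 0)"
    using jacobi_mult_left[OF assms(1)] by simp
  show "(if odd n then jacobi n b else 0) \<in> {-1, 1}" if "coprime n (4 * b)"
  proof -
    have "odd n" "coprime n b" using that by (simp_all add: coprime_4_iff_odd)
    then show ?thesis using jacobi_range[of n b] jacobi_eq_0_iff[OF b, of n] by auto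
  qed
  show "(if odd n then jacobi n b else 0) = 0" if "\<not> coprime n (4 * b)"
  proof -
    have "coprime n (4 * b) \<longleftrightarrow> odd n \<and> coprime n b"
      by (simp add: coprime_4_iff_odd)
    then show ?thesis using jacobi_eq_0_iff[OF b, of n] that by auto
  qed
  show "\<exists>n. (if odd n then jacobi n b else 0) = -1"
    using exists_jacobi_minus_one[OF assms] by auto
qed

text \<open>
  Such a prime is one at which both the character modulo 4 and the Jacobi symbol
  \<open>n \<mapsto> jacobi n b\<close> take the value -1, since reciprocity has no sign when \<open>b\<close> is 1 modulo 4.
\<close>

lemma exists_prime_inert_1_mod_4:
  fixes b :: nat
  assumes "b mod 4 = 1" "\<not> is_square b"
  shows "\<exists>p. prime p \<and> p mod 4 = 3 \<and> Legendre (int b) (int p) = -1"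
proof -
  have "odd b" using assms(1) by presburger
  then have "b > 0" by (rule odd_pos)
  obtain p where p: "prime p"
      "(if coprime p (4 * b) then if p mod 4 = 1 then 1 else -1 else 0) = (-1 :: int)"
      "(if odd p then jacobi p b else 0) = -1"
    using exists_prime_both_minus_one[OF quadratic_character_mod_4[OF \<open>b > 0\<close>]
        quadratic_character_jacobi[OF \<open>odd b\<close> assms(2)]] by blast
  have cop: "coprime p (4 * b)" and "p mod 4 \<noteq> 1" using p(2) by (auto split: if_splits)
  then have "odd p" by (simp add: coprime_4_iff_odd)
  then have p3: "p mod 4 = 3" using \<open>p mod 4 \<noteq> 1\<close> by presburger
  have "\<not> p dvd b" using cop p(1) by (auto dest: coprime_common_divisor)
  then have "jacobi p b = Legendre (int b) (int p)"
    using jacobi_prime_3_mod_4[OF p(1) p3 \<open>odd b\<close>] assms(1) by simp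
  then show ?thesis using p p3 \<open>odd p\<close> by auto
qed

text \<open>
  Factors 4 can be removed. For \<open>a\<close> congruent to 2 or 3 modulo 4, the number \<open>1 + a\<close> or \<open>4 + a\<close> is 3 modulo
  4, so it has a prime factor \<open>p\<close> that is 3 modulo 4, and modulo \<open>p\<close> the number \<open>a\<close> is the negative of a
  nonzero square. When \<open>a\<close> is 1 modulo 4, no such choice works in general (for odd \<open>x\<close> and \<open>a\<close> congruent
  to 1 modulo 8 the odd part of \<open>x\<^sup>2 + a\<close> is 1 modulo 4), and the two characters are needed.
\<close>

theorem exists_prime_3_mod_4_nonresidue:
  fixes a :: nat
  assumes "\<not> is_square a"
  shows "\<exists>p. prime p \<and> p mod 4 = 3 \<and> Legendre (int a) (int p) = -1"
  using assms
proof (induction a rule: less_induct)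
  case (less a)
  have a: "a > 0" using less.prems by (intro Nat.gr0I) auto
  have via_dvd: ?case if "x \<in> {1, 2}" "(x\<^sup>2 + a) mod 4 = 3" for x :: nat
  proof -
    obtain p where p: "prime p" "p mod 4 = 3" "p dvd x\<^sup>2 + a"
      using exists_prime_factor_3_mod_4[OF \<open>(x\<^sup>2 + a) mod 4 = 3\<close>] by blast
    have "\<not> int p dvd int x"
      using that(1) odd_half_of_3_mod_4(2)[OF p(2)] by (auto dest: zdvd_imp_le)
    moreover have "int p dvd (int x)\<^sup>2 + int a" using p(3) by (simp flip: of_nat_power of_nat_add)
    ultimately show ?thesis using Legendre_eq_minus_one_if_dvd[OF p(1,2)] p(1,2) by blast
  qed
  have "a mod 4 = 0 \<or> a mod 4 = 1 \<or> a mod 4 = 2 \<or> a mod 4 = 3" by presburger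
  then consider "4 dvd a" | "a mod 4 = 1" | "a mod 4 = 2" | "a mod 4 = 3" by (auto simp: dvd_eq_mod_eq_0)
  then show ?case
  proof cases
    case 1
    then obtain b where b: "a = 2\<^sup>2 * b" by auto
    have "\<not> is_square b" using less.prems is_nth_power_mult[OF is_nth_power_nth_power[of 2 2], of b] b by blast
    moreover have "b < a" using a b by simp
    ultimately obtain p where p: "prime p" "p mod 4 = 3" "Legendre (int b) (int p) = -1"
      using less.IH by blast
    note p2 = odd_half_of_3_mod_4(2)[OF p(2)]
    have "\<not> int p dvd 2" using p2 by (auto dest: zdvd_imp_le)
    then have "Legendre (2\<^sup>2) (int p) = 1" using p(1) by (intro Legendre_square) auto
    then have "Legendre (int a) (int p) = -1"
      using Legendre_mult[OF p(1) p2, of "2\<^sup>2" "int b"] p(3) b by simp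
    then show ?thesis using p by blast
  next
    case 2
    then show ?thesis using exists_prime_inert_1_mod_4 less.prems by blast
  next
    case 3
    then have "(1\<^sup>2 + a) mod 4 = 3" by (simp, presburger)
    then show ?thesis by (intro via_dvd[of 1]) simp
  next
    case 4
    then show ?thesis by (intro via_dvd[of 2]) simp_all
  qed
qed

section \<open>Valuations of sums of two squares\<close>

lemma dvd_of_dvd_sum_of_squares:
  fixes s t :: int
  assumes p: "prime p" "p mod 4 = 3" and dvd: "int p dvd s\<^sup>2 + t\<^sup>2"
  shows "int p dvd s"
proof (rule ccontr)
  assume s: "\<not> int p dvd s"
  then have "Legendre (t\<^sup>2) (int p) = -1"
    by (rule Legendre_eq_minus_one_if_dvd[OF p dvd])
  moreover have "Legendre (t\<^sup>2) (int p) = 1 \<or> Legendre (t\<^sup>2) (int p) = 0"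
    using Legendre_square[of "int p" t] p(1)
    by (cases "int p dvd t") (auto simp: Legendre_eq_0_iff power2_eq_square)
  ultimately show False by auto
qed

text \<open>
  As soon as \<open>p\<close> divides \<open>s\<^sup>2 + t\<^sup>2\<close> it divides both \<open>s\<close> and \<open>t\<close>, so \<open>p\<^sup>2\<close> can be split off, leaving a smaller
  sum of two squares.
\<close>

lemma even_multiplicity_sum_of_two_squares:
  assumes p: "prime p" "p mod 4 = 3"
    and "sum_of_two_squares N" "N > 0"
  shows "even (multiplicity (int p) N)"
  using assms(3,4)
proof (induction "nat N" arbitrary: N rule: less_induct)
  case less
  obtain s t where N: "N = s\<^sup>2 + t\<^sup>2" using less.prems by (auto simp: sum_of_two_squares_def)
  show ?case
  proof (cases "int p dvd N")
    case True
    then have "int p dvd s" "int p dvd t"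
      using dvd_of_dvd_sum_of_squares[OF p, of s t] dvd_of_dvd_sum_of_squares[OF p, of t s] N
      by (simp_all add: add.commute)
    then obtain u v where uv: "s = int p * u" "t = int p * v" by (auto elim!: dvdE)
    define K where "K = u\<^sup>2 + v\<^sup>2"
    have N': "N = (int p)\<^sup>2 * K" by (simp add: N uv K_def algebra_simps power_mult_distrib)
    have "K > 0" using less.prems(2) by (simp add: N' zero_less_mult_iff)
    have "1 < (int p)\<^sup>2" using prime_gt_1_nat[OF p(1)] by (simp add: one_less_power)
    then have "K < N" using \<open>K > 0\<close> by (simp add: N')
    then have "even (multiplicity (int p) K)"
      using less.hyps[of K] \<open>K > 0\<close> by (auto simp: sum_of_two_squares_def K_def)
    moreover have "multiplicity (int p) N = 2 + multiplicity (int p) K"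
      using \<open>K > 0\<close> p(1) unfolding N'
      by (subst prime_elem_multiplicity_mult_distrib) (auto simp: prime_elem_multiplicity_power_distrib prime_gt_0_nat)
    ultimately show ?thesis by simp
  qed (simp add: not_dvd_imp_multiplicity_0)
qed

text \<open>
  Lifting the exponent. The cofactor \<open>S\<close> of \<open>x + 1\<close> in \<open>x ^ p + 1\<close> is \<open>1 - x + x\<^sup>2 - \<dots>\<close>, whose terms are
  1 modulo \<open>p\<close>; an expansion to first order in \<open>p\<close> gives \<open>S \<equiv> p\<close> modulo \<open>p\<^sup>2\<close>.
\<close>

lemma multiplicity_power_prime_plus_one:
  fixes x :: int
  assumes p: "prime p" "odd p" and dvd: "int p dvd x + 1" and x: "x > 0"
  shows "multiplicity (int p) (x ^ p + 1) = Suc (multiplicity (int p) (x + 1))"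
proof -
  define S where "S = (\<Sum>i<p. (- x) ^ i)"
  have factor: "x ^ p + 1 = (x + 1) * S"
    using power_diff_1_eq[of "- x" p] p(2) by (simp add: S_def algebra_simps)
  obtain t where t: "- x = 1 + int p * t"
  proof -
    obtain t where "x + 1 = int p * t" using dvd by auto
    then have "- x = 1 + int p * (- t)" by simp
    then show ?thesis using that by blast
  qed
  have power: "[(- x) ^ i = 1 + int i * (int p * t)] (mod (int p)\<^sup>2)" for i
  proof (induction i)
    case (Suc i)
    have "[(- x) ^ Suc i = (1 + int p * t) * (1 + int i * (int p * t))] (mod (int p)\<^sup>2)"
      using Suc.IH by (simp add: t cong_mult)
    also have "(1 + int p * t) * (1 + int i * (int p * t))
        = 1 + int (Suc i) * (int p * t) + (int p)\<^sup>2 * (int i * t\<^sup>2)"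
      by (simp add: algebra_simps power2_eq_square)
    also have "[\<dots> = 1 + int (Suc i) * (int p * t)] (mod (int p)\<^sup>2)"
      by (simp add: cong_iff_dvd_diff)
    finally show ?case .
  qed simp
  obtain h where h: "p = 2 * h + 1" using p(2) by (rule oddE)
  have "[S = (\<Sum>i<p. 1 + int i * (int p * t))] (mod (int p)\<^sup>2)"
    unfolding S_def using power by (intro cong_sum)
  also have "(\<Sum>i<p. 1 + int i * (int p * t)) = int p + (\<Sum>i<p. int i) * (int p * t)"
    by (simp add: sum.distrib sum_distrib_right)
  \<comment> \<open>Oddness of \<open>p\<close> makes this sum divisible by \<open>p\<close>, which kills the first-order term.\<close>
  also have "(\<Sum>i<p. int i) = int p * int h"
  proof -
    have "2 * (\<Sum>i<n. int i) = int n * (int n - 1)" for n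
      by (induction n) (simp_all add: algebra_simps)
    from this[of p] show ?thesis by (simp add: h algebra_simps)
  qed
  also have "int p + int p * int h * (int p * t) = int p + (int p)\<^sup>2 * (int h * t)"
    by (simp add: power2_eq_square)
  also have "[\<dots> = int p] (mod (int p)\<^sup>2)" by (simp add: cong_iff_dvd_diff)
  finally have S: "[S = int p] (mod (int p)\<^sup>2)" .
  have p1: "int p > 1" using prime_gt_1_nat[OF p(1)] by simp
  have "\<not> (int p)\<^sup>2 dvd int p"
    using p1 by (auto simp: power2_eq_square dest!: zdvd_imp_le)
  then have "\<not> int p ^ Suc 1 dvd S" using cong_dvd_iff[OF S] by (simp add: numeral_2_eq_2)
  moreover have "int p ^ 1 dvd S"
    using cong_dvd_iff[OF cong_dvd_modulus[OF S, of "int p"]] by (simp add: power2_eq_square)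
  ultimately have "multiplicity (int p) S = 1" by (rule multiplicity_eqI[rotated])
  moreover have "S \<noteq> 0" using \<open>\<not> int p ^ Suc 1 dvd S\<close> by auto
  ultimately show ?thesis
    unfolding factor using p(1) x by (subst prime_elem_multiplicity_mult_distrib) auto
qed

section \<open>Sums of two squares among the numbers a^n + 1\<close>

theorem theorem1p1:
  fixes a :: int
  assumes "a > 0"
  shows "(\<forall>n::nat. n > 0 \<longrightarrow> sum_of_two_squares (a ^ n + 1)) \<longleftrightarrow> is_square a"
proof
  assume "is_square a"
  then obtain b where "a = b\<^sup>2" by (rule is_nth_powerE)
  then have "a ^ n + 1 = (b ^ n)\<^sup>2 + 1\<^sup>2" for n by (simp add: power_mult[symmetric] mult.commute)
  then show "\<forall>n::nat. n > 0 \<longrightarrow> sum_of_two_squares (a ^ n + 1)"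
    unfolding sum_of_two_squares_def by blast
next
  assume sums: "\<forall>n::nat. n > 0 \<longrightarrow> sum_of_two_squares (a ^ n + 1)"
  show "is_square a"
  proof (rule ccontr)
    assume nonsquare: "\<not> is_square a"
    have "\<not> is_square (nat a)"
    proof
      assume "is_square (nat a)"
      then obtain b where "nat a = b\<^sup>2" by (rule is_nth_powerE)
      then have "a = (int b)\<^sup>2" using assms by (metis int_nat_eq of_nat_power less_imp_le)
      then show False using nonsquare by simp
    qed
    then obtain p where p: "prime p" "p mod 4 = 3" "Legendre a (int p) = -1"
      using exists_prime_3_mod_4_nonresidue[of "nat a"] assms by auto
    define n where "n = (p - 1) div 2"
    have n: "odd n" and p2: "p > 2" using odd_half_of_3_mod_4[OF p(2)] by (simp_all add: n_def)
    then have "n > 0" by (simp add: odd_pos)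
    have "odd p" using p(2) by presburger
    have pos: "a ^ k > 0" for k using assms by simp
    have "[-1 = a ^ n] (mod int p)"
      using euler_criterion[OF p(1) p2, of a] p(3) by (simp add: n_def)
    then have "int p dvd a ^ n + 1"
      by (metis cong_iff_dvd_diff cong_sym diff_minus_eq_add)
    then have "multiplicity (int p) (a ^ (n * p) + 1) = Suc (multiplicity (int p) (a ^ n + 1))"
      unfolding power_mult by (rule multiplicity_power_prime_plus_one[OF p(1) \<open>odd p\<close> _ pos])
    moreover have "even (multiplicity (int p) (a ^ k + 1))" if "k > 0" for k
      using even_multiplicity_sum_of_two_squares[OF p(1,2)] sums that pos[of k] by simp
    \<comment> \<open>The valuations at \<open>n\<close> and at \<open>n * p\<close> are consecutive numbers and cannot both be even.\<close>
    ultimately show False using \<open>n > 0\<close> p2 by (metis even_Suc mult_pos_pos zero_less_numeral less_trans)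
  qed
qed

end
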